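(* Let $m\neq0$ be an integer and let $c_1,c_2,\dots,c_{\varphi(m)}$ be a reduced residue system modulo $m$, ordered so that $c_1'<c_2'<\dots<c_{\varphi(m)}'$, where $c_i'$ denotes the integer with $0\le c_i'<|m|$ and $c_i\equiv c_i'\pmod m$. Then $$c_1c_2\cdots c_{\varphi(m)-1}\equiv 1\pmod m\ \text{ if } m\in A,\qquad c_1c_2\cdots c_{\varphi(m)-1}\equiv-1\pmod m\ \text{ if } m\notin A,$$ where an empty product equals $1$.
   Context: $A$ is the set of integers $m$ such that $m=\pm p^{\beta}$ or $m=\pm2p^{\beta}$ with $p$ an odd prime and $\beta\ge1$ an integer, or $m=\pm2^{\alpha}$ with $\alpha\in\{0,1,2\}$, or $m=0$. For a nonzero integer $m$, $\varphi(m)=\varphi(|m|)$ is Euler's function, and a reduced residue system modulo $m$ is a family of $\varphi(m)$ integers containing exactly one representative of each residue class modulo $m$ relatively prime to $m$. *)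

theory Defs
  imports "HOL-Number_Theory.Number_Theory"
begin

definition A :: "int set" where
  "A = {m. (\<exists>p \<beta>. prime p \<and> odd p \<and> \<beta> \<ge> (1::nat) \<and>
              (m = p ^ \<beta> \<or> m = - (p ^ \<beta>) \<or> m = 2 * p ^ \<beta> \<or> m = - (2 * p ^ \<beta>)))
         \<or> (\<exists>\<alpha>\<in>{0, 1, 2 :: nat}. m = 2 ^ \<alpha> \<or> m = - (2 ^ \<alpha>))
         \<or> m = 0}"

definition phi :: "int \<Rightarrow> nat" where
  "phi m = totient (nat \<bar>m\<bar>)"

(* The family is c 1, ..., c (phi m); other values of c are irrelevant.  As there are
   phi m coprime residue classes and phi m indices, every c i is coprime to m. *)
definition reduced_residue_system :: "int \<Rightarrow> (nat \<Rightarrow> int) \<Rightarrow> bool" where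
  "reduced_residue_system m c \<longleftrightarrow>
     (\<forall>a. coprime a m \<longrightarrow> (\<exists>!i. i \<in> {1..phi m} \<and> [c i = a] (mod m)))"

end

theory Submission
  imports Defs
begin

text \<open>
  Write \<open>n = \<bar>m\<bar>\<close>.  For \<open>n \<le> 2\<close> the product is empty and \<open>1\<close> and \<open>-1\<close> agree modulo \<open>n\<close>, so let
  \<open>n > 2\<close>.  The ordering only serves to identify the omitted factor: its residue is the largest
  one, namely \<open>n - 1\<close>, so the omitted factor is \<open>-1\<close> and the claim is that the product \<open>P\<close> of all
  reduced residues is \<open>-1\<close> for \<open>m \<in> A\<close> and \<open>1\<close> otherwise (Gauss's generalisation of Wilson's
  theorem).

  To compute \<open>P\<close>, let \<open>\<lambda>\<close> be the exponent of the unit group (the Carmichael function) and let \<open>g\<close>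
  be a unit of order \<open>\<lambda>\<close>.  Since \<open>\<lambda>\<close> is even, \<open>g\<close> is not a square: \<open>g = x\<^sup>2\<close> would give
  \<open>g ^ (\<lambda> div 2) = x ^ \<lambda> = 1\<close>.  Hence the units fall into pairs \<open>{x, g / x}\<close> of distinct elements
  with product \<open>g\<close>, and \<open>P = g ^ (totient n div 2)\<close> (lemma \<open>prod_totatives_cong_power\<close>).  The set
  \<open>A\<close> consists, up to sign and zero, of the moduli with a primitive root.

  If there is a primitive root, then \<open>g\<close> generates the unit group and \<open>g ^ (totient n div 2)\<close> is
  its only element of order two, which is \<open>-1\<close>.  If there is none, then \<open>n\<close> is a power of two
  that is at least \<open>8\<close>, or a product of two coprime factors greater than two; in both cases \<open>\<lambda>\<close>
  divides \<open>totient n div 2\<close> (lemma \<open>Carmichael_dvd_half_totient\<close>), so \<open>P = 1\<close>.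
\<close>

section \<open>The product of all reduced residues\<close>

text \<open>
  Each element is matched with its unique partner, and no element is its own partner, so the set
  splits into two-element blocks of product \<open>a\<close>.
\<close>
lemma prod_cong_power_of_pairing:
  fixes S :: "nat set" and a n :: nat
  assumes "finite S"
    and "\<And>x. x \<in> S \<Longrightarrow> \<exists>!y. y \<in> S \<and> [x * y = a] (mod n)"
    and "\<And>x. x \<in> S \<Longrightarrow> \<not> [x * x = a] (mod n)"
  shows "[\<Prod>S = a ^ (card S div 2)] (mod n)"
  using assms
proof (induction "card S" arbitrary: S rule: less_induct)
  case less
  show ?case
  proof (cases "S = {}")
    case False
    then obtain x where x: "x \<in> S" by blast
    obtain y where y: "y \<in> S" "[x * y = a] (mod n)" using less.prems(2)[OF x] by blast
    have neq: "x \<noteq> y" using less.prems(3)[OF x] y by blast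
    define T where "T = S - {x, y}"
    have S: "S = insert x (insert y T)" "x \<notin> insert y T" "y \<notin> T" "finite T"
      using x y neq less.prems(1) by (auto simp: T_def)
    have cardS: "card S = Suc (Suc (card T))" using S by simp
    have "[\<Prod>T = a ^ (card T div 2)] (mod n)"
    proof (rule less.hyps)
      show "card T < card S" using cardS by simp
      show "finite T" by fact
      show "\<not> [z * z = a] (mod n)" if "z \<in> T" for z
        using that less.prems(3) by (auto simp: T_def)
      show "\<exists>!w. w \<in> T \<and> [z * w = a] (mod n)" if z: "z \<in> T" for z
      proof -
        have zS: "z \<in> S" "z \<noteq> x" "z \<noteq> y" using z by (auto simp: T_def)
        obtain w where w: "w \<in> S" "[z * w = a] (mod n)" using less.prems(2)[OF zS(1)] by blast
        have "w \<noteq> x"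
        proof
          assume "w = x"
          hence "[x * z = a] (mod n)" using w by (simp add: mult.commute)
          thus False using less.prems(2)[OF x] y zS by blast
        qed
        moreover have "w \<noteq> y"
        proof
          assume "w = y"
          hence "[y * z = a] (mod n)" "[y * x = a] (mod n)"
            using w y by (simp_all add: mult.commute)
          thus False using less.prems(2)[OF y(1)] x zS by blast
        qed
        ultimately have "w \<in> T" using w by (simp add: T_def)
        moreover have "T \<subseteq> S" by (auto simp: T_def)
        ultimately show ?thesis using w less.prems(2)[OF zS(1)] by blast
      qed
    qed
    hence "[(x * y) * \<Prod>T = a * a ^ (card T div 2)] (mod n)"
      using y(2) by (rule cong_mult[rotated])
    moreover have "\<Prod>S = (x * y) * \<Prod>T" using S by (simp add: mult.assoc)
    ultimately show ?thesis using cardS by simp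
  qed simp
qed

lemma ex1_totative_quotient:
  fixes n :: nat
  assumes n: "n > 1" and a: "coprime a n" and x: "x \<in> totatives n"
  shows "\<exists>!y. y \<in> totatives n \<and> [x * y = a] (mod n)"
proof -
  have cx: "coprime x n" using x by (simp add: totatives_def)
  obtain z where z: "[x * z = 1] (mod n)" using cong_solve_coprime_nat[OF cx] by auto
  define y where "y = (z * a) mod n"
  have "[x * y = (x * z) * a] (mod n)"
    by (simp add: y_def cong_def mod_mult_right_eq mult.assoc)
  also have "[(x * z) * a = 1 * a] (mod n)" using z by (rule cong_mult) simp
  finally have xy: "[x * y = a] (mod n)" by simp
  have "coprime (x * y) n"
    using cong_imp_coprime[OF cong_sym[OF xy]] a by simp
  hence cy: "coprime y n" by simp
  have "y > 0" using cy n by (intro Nat.gr0I) auto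
  moreover have "y \<le> n" using n by (simp add: y_def)
  ultimately have yt: "y \<in> totatives n" using cy by (simp add: totatives_def)
  have "w = y" if w: "w \<in> totatives n" "[x * w = a] (mod n)" for w
  proof -
    have "[x * w = x * y] (mod n)" using w(2) xy cong_sym cong_trans by blast
    hence "[w = y] (mod n)" using cx by (simp add: cong_mult_lcancel_nat)
    thus ?thesis
      using totatives_less[OF w(1) n] totatives_less[OF yt n] by (simp add: cong_def)
  qed
  thus ?thesis using xy yt by blast
qed

text \<open>
  An element of the maximal order \<open>Carmichael n\<close> is not a square, because that order is even and
  every unit has trivial \<open>Carmichael n\<close>-th power.
\<close>
lemma prod_totatives_cong_power:
  fixes n g :: nat
  assumes n: "n > 2" and g: "g \<in> totatives n" and ord: "ord n g = Carmichael n"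
  shows "[\<Prod>(totatives n) = g ^ (totient n div 2)] (mod n)"
  unfolding totient_def
proof (rule prod_cong_power_of_pairing)
  have cg: "coprime g n" using g by (simp add: totatives_def)
  show "\<exists>!y. y \<in> totatives n \<and> [x * y = g] (mod n)" if "x \<in> totatives n" for x
    using ex1_totative_quotient[OF _ cg that] n by simp
  show "\<not> [x * x = g] (mod n)" if x: "x \<in> totatives n" for x
  proof
    assume sq: "[x * x = g] (mod n)"
    obtain h where h: "Carmichael n = 2 * h" using even_Carmichael[OF n] by blast
    have "[g ^ h = (x * x) ^ h] (mod n)" using sq by (intro cong_pow) (rule cong_sym)
    also have "(x * x) ^ h = x ^ Carmichael n"
      by (simp add: h power_mult power2_eq_square)
    also have "[x ^ Carmichael n = 1] (mod n)"
      using n x by (intro power_Carmichael_eq_1) (auto simp: totatives_def coprime_commute)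
    finally have "Carmichael n dvd h" using ord_divides[of g h n] ord by simp
    thus False using h Carmichael_pos[of n] by (auto dest: dvd_imp_le)
  qed
qed simp

section \<open>Moduli with a primitive root\<close>

text \<open>
  Write \<open>-1\<close> as \<open>g ^ i\<close> with \<open>i < totient n\<close>.  Squaring shows that \<open>totient n\<close> divides \<open>2 * i\<close>,
  and \<open>i \<noteq> 0\<close> because \<open>-1\<close> and \<open>1\<close> differ modulo \<open>n > 2\<close>; this leaves only
  \<open>i = totient n div 2\<close>.
\<close>
lemma power_half_totient_primroot:
  fixes n g :: nat
  assumes n: "n > 2" and g: "residue_primroot n g"
  shows "[g ^ (totient n div 2) = n - 1] (mod n)"
proof -
  have ord: "ord n g = totient n" using g by (simp add: residue_primroot_def)
  have "n - 1 \<in> (\<lambda>i. g ^ i mod n) ` {..<totient n}"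
    using residue_primroot_is_generator[OF _ g] minus_one_in_totatives[of n] n
    by (simp add: bij_betw_def)
  then obtain i where i: "i < totient n" "n - 1 = g ^ i mod n" by auto
  have gi: "[g ^ i = n - 1] (mod n)" using i(2) n by (simp add: cong_def)
  have "[g ^ i * g ^ i = (n - 1) * (n - 1)] (mod n)" using gi gi by (rule cong_mult)
  also have "(n - 1) * (n - 1) = 1 + (n - 2) * n"
  proof -
    obtain k where "n = k + 2" using n by (metis add.commute less_imp_add_positive)
    thus ?thesis by (simp add: algebra_simps)
  qed
  also have "[1 + (n - 2) * n = 1] (mod n)" unfolding cong_def by (rule mod_mult_self1)
  finally have "[g ^ (2 * i) = 1] (mod n)" by (simp add: mult_2 power_add)
  hence "totient n dvd 2 * i" using ord_divides[of g "2 * i" n] ord by simp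
  moreover have "i \<noteq> 0"
  proof
    assume "i = 0"
    thus False using i(2) n by simp
  qed
  ultimately obtain q where q: "2 * i = totient n * q" "q > 0"
    by (metis dvdE mult_0_right mult_eq_0_iff neq0_conv zero_neq_numeral)
  have "totient n * q < totient n * 2" using i(1) q(1) by linarith
  hence "q = 1" using q(2) by simp
  hence "2 * i = totient n" using q(1) by simp
  hence "i = totient n div 2" by simp
  thus ?thesis using gi by simp
qed

section \<open>Moduli without a primitive root\<close>

text \<open>
  If some odd prime divides \<open>n\<close>, its full power in \<open>n\<close> is one factor; the cofactor exceeds two,
  since otherwise \<open>n\<close> would be that odd prime power or twice it.
\<close>
lemma not_cyclic_moduli_cases:
  fixes n :: nat
  assumes "n > 0" "n \<notin> cyclic_moduli"
  obtains (twopow) k where "k \<ge> 3" "n = 2 ^ k"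
  | (coprime) a b where "a > 2" "b > 2" "coprime a b" "n = a * b"
proof (cases "\<exists>p. prime p \<and> odd p \<and> p dvd n")
  case True
  then obtain p where p: "prime p" "odd p" "p dvd n" by blast
  obtain j s where s: "n = p ^ j * s" "\<not> p dvd s"
    using multiplicity_decompose'[of n p] assms(1) p(1) by (metis not_prime_unit neq0_conv)
  have j: "j > 0" using p(3) s by (intro Nat.gr0I) auto
  have "p > 2" using p prime_ge_2_nat[of p] by (cases "p = 2") auto
  moreover have "p \<le> p ^ j" using j p(1) by (intro self_le_power prime_ge_1_nat)
  ultimately have pj: "p ^ j > 2" by linarith
  have "s > 2"
  proof (rule ccontr)
    assume "\<not> s > 2"
    moreover have "s \<noteq> 0" using s(2) by (intro notI) simp
    ultimately have "n = p ^ j \<or> n = 2 * p ^ j" using s(1) by (cases "s = 1") auto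
    moreover have "p ^ j \<in> {p ^ k |p k. prime p \<and> odd p \<and> k > 0}"
      "2 * p ^ j \<in> {2 * p ^ k |p k. prime p \<and> odd p \<and> k > 0}"
      using p(1,2) j by blast+
    ultimately show False using assms(2) unfolding cyclic_moduli_def by (elim disjE) simp_all
  qed
  moreover have "coprime (p ^ j) s" using p(1) s(2) by (simp add: prime_imp_coprime)
  ultimately show ?thesis using coprime pj s(1) by blast
next
  case False
  obtain k where k: "n = 2 ^ k"
  proof -
    obtain l r where r: "n = 2 ^ l * r" "odd r"
      using multiplicity_decompose'[of n 2] assms(1)
      by (metis neq0_conv not_prime_unit two_is_prime_nat)
    have "r = 1"
    proof (rule ccontr)
      assume "r \<noteq> 1"
      then obtain p where "prime p" "p dvd r" using prime_factor_nat by blast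
      moreover from this have "odd p" using r(2) by (meson dvd_trans)
      moreover have "p dvd n" using r(1) \<open>p dvd r\<close> by (metis dvd_mult)
      ultimately show False using False by blast
    qed
    thus ?thesis using r(1) that by simp
  qed
  have "k \<ge> 3"
  proof (rule ccontr)
    assume "\<not> k \<ge> 3"
    hence "k = 0 \<or> k = 1 \<or> k = 2" by auto
    thus False using assms(2) k by (auto simp: cyclic_moduli_def)
  qed
  thus ?thesis using k twopow by blast
qed

text \<open>
  For coprime factors greater than two both totients are even, so their least common multiple
  divides half of their product.
\<close>
lemma Carmichael_dvd_half_totient:
  fixes n :: nat
  assumes "n > 0" "n \<notin> cyclic_moduli"
  shows "Carmichael n dvd totient n div 2"
  using assms
proof (cases rule: not_cyclic_moduli_cases)
  case (twopow k)
  have "totient n = 2 ^ (k - 1)"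
    using twopow by (simp add: totient_prime_power)
  moreover have "k - 1 = Suc (k - 2)" using twopow by simp
  ultimately show ?thesis using twopow by (simp add: Carmichael_twopow_ge_8)
next
  case (coprime a b)
  obtain u where u: "totient a = 2 * u" using totient_even[of a] coprime by blast
  obtain v where v: "totient b = 2 * v" using totient_even[of b] coprime by blast
  have half: "totient n div 2 = totient a * v" "totient n div 2 = u * totient b"
    using coprime by (simp_all add: totient_mult_coprime u v)
  have "Carmichael a dvd totient n div 2"
    unfolding half(1) by (intro dvd_mult2 Carmichael_dvd_totient)
  moreover have "Carmichael b dvd totient n div 2"
    unfolding half(2) by (intro dvd_mult Carmichael_dvd_totient)
  ultimately show ?thesis using coprime by (simp add: Carmichael_mult_coprime)
qed

text \<open>Gauss's generalisation of Wilson's theorem.\<close>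
theorem prod_totatives_cong:
  fixes n :: nat
  assumes n: "n > 2"
  shows "[(\<Prod>x\<in>totatives n. int x) = (if n \<in> cyclic_moduli then -1 else 1)] (mod int n)"
proof -
  obtain g where g: "g \<in> totatives n" "ord n g = Carmichael n"
    using Carmichael_root_exists[of n] n by auto
  have cg: "coprime n g" using g by (simp add: totatives_def coprime_commute)
  have P: "[\<Prod>(totatives n) = g ^ (totient n div 2)] (mod n)"
    using prod_totatives_cong_power[OF n g] .
  show ?thesis
  proof (cases "n \<in> cyclic_moduli")
    case True
    hence "Carmichael n = totient n"
      using residue_primroot_iff_in_cyclic_moduli residue_primroot_iff_Carmichael by blast
    hence "residue_primroot n g" using g cg n by (simp add: residue_primroot_def)
    hence "[\<Prod>(totatives n) = n - 1] (mod n)"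
      using P power_half_totient_primroot[OF n] cong_trans by blast
    hence "[int (\<Prod>(totatives n)) = int (n - 1)] (mod int n)"
      by (simp only: cong_int_iff)
    also have "int (n - 1) = int n - 1" using n by simp
    also have "[int n - 1 = -1] (mod int n)" by (simp add: cong_iff_dvd_diff)
    finally show ?thesis using True by simp
  next
    case False
    hence "[g ^ (totient n div 2) = 1] (mod n)"
      using Carmichael_dvd_half_totient n cg by (intro Carmichael_divides) auto
    hence "[\<Prod>(totatives n) = 1] (mod n)" using P cong_trans by blast
    hence "[int (\<Prod>(totatives n)) = int 1] (mod int n)" by (simp only: cong_int_iff)
    thus ?thesis using False by simp
  qed
qed

section \<open>Ordered reduced residue systems\<close>

lemma in_A_iff_cyclic_moduli:
  assumes "m \<noteq> 0"
  shows "m \<in> A \<longleftrightarrow> nat \<bar>m\<bar> \<in> cyclic_moduli"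
proof
  assume "m \<in> A"
  then consider
      (pow) p \<beta> where "prime p" "odd p" "\<beta> \<ge> 1" "\<bar>m\<bar> = p ^ \<beta> \<or> \<bar>m\<bar> = 2 * p ^ \<beta>"
    | (two) "\<bar>m\<bar> \<in> {1, 2, 4}"
    using assms unfolding A_def
    by (auto simp: abs_mult power_abs prime_ge_0_int)
  thus "nat \<bar>m\<bar> \<in> cyclic_moduli"
  proof cases
    case pow
    define q where "q = nat p"
    have q: "p = int q" "prime q" "odd q"
      using pow prime_ge_0_int[of p] by (auto simp: q_def even_nat_iff)
    have "nat \<bar>m\<bar> = q ^ \<beta> \<or> nat \<bar>m\<bar> = 2 * q ^ \<beta>"
      using pow(4) unfolding q(1) by (auto simp: nat_mult_distrib nat_power_eq)
    moreover have "q ^ \<beta> \<in> {p ^ k |p k. prime p \<and> odd p \<and> k > 0}"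
      "2 * q ^ \<beta> \<in> {2 * p ^ k |p k. prime p \<and> odd p \<and> k > 0}"
      using q(2,3) pow(3) by (blast intro: less_le_trans[OF zero_less_one])+
    ultimately show ?thesis unfolding cyclic_moduli_def by (elim disjE) simp_all
  next
    case two
    thus ?thesis by (auto simp: cyclic_moduli_def)
  qed
next
  assume "nat \<bar>m\<bar> \<in> cyclic_moduli"
  then consider
      (pow) p k where "prime p" "odd p" "k > 0" "nat \<bar>m\<bar> = p ^ k \<or> nat \<bar>m\<bar> = 2 * p ^ k"
    | (two) "nat \<bar>m\<bar> \<in> {1, 2, 4}"
    unfolding cyclic_moduli_def by blast
  thus "m \<in> A"
  proof cases
    case pow
    have "prime (int p)" "odd (int p)" "k \<ge> 1" using pow by auto
    moreover have "\<bar>m\<bar> = int p ^ k \<or> \<bar>m\<bar> = 2 * int p ^ k"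
      using pow(4) by (metis abs_ge_zero int_nat_eq of_nat_mult of_nat_numeral of_nat_power)
    hence "m = int p ^ k \<or> m = - (int p ^ k) \<or> m = 2 * int p ^ k \<or> m = - (2 * int p ^ k)"
      by linarith
    ultimately show ?thesis unfolding A_def by blast
  next
    case two
    hence "m \<in> {1, -1, 2, -2, 4, -4}" by auto
    thus ?thesis by (auto simp: A_def)
  qed
qed

text \<open>
  There are as many residues as there are indices, so the strictly increasing residues are exactly
  the totatives.
\<close>
lemma bij_betw_reduced_residues:
  fixes m :: int and c :: "nat \<Rightarrow> int"
  assumes m: "\<bar>m\<bar> > 1"
    and rrs: "reduced_residue_system m c"
    and mono: "strict_mono_on {1..phi m} (\<lambda>i. c i mod \<bar>m\<bar>)"
  shows "bij_betw (\<lambda>i. c i mod \<bar>m\<bar>) {1..phi m} (int ` totatives (nat \<bar>m\<bar>))"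
proof -
  define n where "n = nat \<bar>m\<bar>"
  have n: "n > 1" "\<bar>m\<bar> = int n" using m by (auto simp: n_def)
  let ?r = "\<lambda>i. c i mod \<bar>m\<bar>"
  have inj: "inj_on ?r {1..phi m}" using mono by (rule strict_mono_on_imp_inj_on)
  have sub: "int ` totatives n \<subseteq> ?r ` {1..phi m}"
  proof safe
    fix x assume x: "x \<in> totatives n"
    have "coprime (int x) \<bar>m\<bar>" using x by (simp add: n(2) totatives_def)
    hence "coprime (int x) m" by simp
    then obtain i where i: "i \<in> {1..phi m}" "[c i = int x] (mod m)"
      using rrs unfolding reduced_residue_system_def by blast
    have "[c i = int x] (mod \<bar>m\<bar>)" using i(2) by (simp add: cong_iff_dvd_diff)
    hence "?r i = int x"
      using totatives_less[OF x n(1)] by (simp add: cong_def n(2))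
    thus "int x \<in> ?r ` {1..phi m}" using i(1) by force
  qed
  have "card (int ` totatives n) = card (?r ` {1..phi m})"
    using inj by (simp add: card_image phi_def totient_def n_def)
  hence "int ` totatives n = ?r ` {1..phi m}" using sub by (intro card_subset_eq) auto
  thus ?thesis using inj by (simp add: bij_betw_def n_def)
qed

text \<open>
  The residue \<open>\<bar>m\<bar> - 1\<close> is attained because it is coprime to \<open>m\<close>, and being the largest possible
  residue it must sit at the last index.
\<close>
lemma last_residue_cong_minus_one:
  fixes m :: int and c :: "nat \<Rightarrow> int"
  assumes m: "\<bar>m\<bar> > 1"
    and rrs: "reduced_residue_system m c"
    and mono: "strict_mono_on {1..phi m} (\<lambda>i. c i mod \<bar>m\<bar>)"
  shows "[c (phi m) = -1] (mod m)"
proof -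
  let ?r = "\<lambda>i. c i mod \<bar>m\<bar>"
  have "nat \<bar>m\<bar> - 1 \<in> totatives (nat \<bar>m\<bar>)" using m by (intro minus_one_in_totatives) auto
  hence "int (nat \<bar>m\<bar> - 1) \<in> ?r ` {1..phi m}"
    using bij_betw_reduced_residues[OF assms] by (auto simp: bij_betw_def)
  then obtain i where i: "i \<in> {1..phi m}" "?r i = \<bar>m\<bar> - 1" using m by auto
  have "?r i \<le> ?r (phi m)"
    using strict_mono_onD[OF mono, of i "phi m"] i(1) by (cases "i = phi m") auto
  moreover have "?r (phi m) < \<bar>m\<bar>" using m by (intro pos_mod_bound) auto
  ultimately have "?r (phi m) = \<bar>m\<bar> - 1" using i(2) by simp
  hence "[c (phi m) = \<bar>m\<bar> - 1] (mod \<bar>m\<bar>)" using m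
    unfolding cong_def by (subst mod_pos_pos_trivial[of "\<bar>m\<bar> - 1"]) auto
  also have "[\<bar>m\<bar> - 1 = -1] (mod \<bar>m\<bar>)" by (simp add: cong_iff_dvd_diff)
  finally show ?thesis by (simp add: cong_iff_dvd_diff)
qed

theorem mainTheorem3:
  fixes m :: int and c :: "nat \<Rightarrow> int"
  assumes "m \<noteq> 0"
    and "reduced_residue_system m c"
    and "strict_mono_on {1..phi m} (\<lambda>i. c i mod \<bar>m\<bar>)"
  shows "(m \<in> A \<longrightarrow> [(\<Prod>i = 1..phi m - 1. c i) = 1] (mod m)) \<and>
         (m \<notin> A \<longrightarrow> [(\<Prod>i = 1..phi m - 1. c i) = -1] (mod m))"
proof (cases "\<bar>m\<bar> > 2")
  case False
  hence n: "nat \<bar>m\<bar> = 1 \<or> nat \<bar>m\<bar> = 2" using assms(1) by linarith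
  hence "phi m = 1" by (auto simp: phi_def)
  moreover have "m \<in> A" using n assms(1) by (auto simp: in_A_iff_cyclic_moduli cyclic_moduli_def)
  ultimately show ?thesis by simp
next
  case True
  define n where "n = nat \<bar>m\<bar>"
  have n: "n > 2" using True by (simp add: n_def)
  have m1: "\<bar>m\<bar> > 1" using True by simp
  define e :: int where "e = (if m \<in> A then -1 else 1)"
  define Q where "Q = (\<Prod>i = 1..phi m - 1. c i)"
  have "phi m > 0" using n by (simp add: phi_def n_def)
  hence split: "(\<Prod>i = 1..phi m. c i) = Q * c (phi m)"
    unfolding Q_def using prod.nat_ivl_Suc'[of 1 "phi m - 1" c] by (simp add: mult.commute)
  have "[(\<Prod>i = 1..phi m. c i) = (\<Prod>i = 1..phi m. c i mod \<bar>m\<bar>)] (mod \<bar>m\<bar>)"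
    by (intro cong_prod) (simp add: cong_def)
  also have "(\<Prod>i = 1..phi m. c i mod \<bar>m\<bar>) = \<Prod>(int ` totatives n)"
    unfolding n_def
    using prod.reindex_bij_betw[OF bij_betw_reduced_residues[OF m1 assms(2,3)], of "\<lambda>x. x"] .
  also have "\<dots> = (\<Prod>x\<in>totatives n. int x)" by (simp add: prod.reindex)
  also have "[\<dots> = e] (mod \<bar>m\<bar>)"
    using prod_totatives_cong[OF n] assms(1)
    by (simp add: e_def in_A_iff_cyclic_moduli n_def)
  finally have "[Q * c (phi m) = e] (mod m)" unfolding split by (simp add: cong_iff_dvd_diff)
  moreover have "[Q * c (phi m) = Q * -1] (mod m)"
    using last_residue_cong_minus_one[OF m1 assms(2,3)] by (intro cong_mult) auto
  ultimately have "[Q * -1 = e] (mod m)" using cong_sym cong_trans by blast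
  hence "[-1 * (Q * -1) = -1 * e] (mod m)" by (intro cong_mult) auto
  hence "[Q = - e] (mod m)" by simp
  thus ?thesis by (cases "m \<in> A") (simp_all add: e_def Q_def)
qed

end
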